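(* There is a constant $C$ such that for every linear diagram with $n$ vertices, every non-negative integer $w$ and every finite sequence $r$ of right exchanges starting from that diagram, the cost of $r$ at weight $w$ is at most $C(n^3+w n^2)$.
   Context: A diagram is a tuple $D=(S,N,H,I,O)$, $S,N\in\mathbb N$, $H,I,O:\{0,\dots,N-1\}\to\mathbb N$; $\Delta(n)=O(n)-I(n)$, $W(0)=S$, $W(n+1)=W(n)+\Delta(n)$; valid if $W(n)\ge H(n)+I(n)$ for all $n$. The vertex at height $n$ (heights numbered top to bottom) has as inputs the wires $H(n),\dots,H(n)+I(n)-1$ among the $W(n)$ wires crossing level $n$ (numbered left to right) and as outputs wires $H(n),\dots,H(n)+O(n)-1$ of level $n+1$; wire $k<H(n)$ of level $n$ continues as wire $k$ of level $n+1$, wire $k\ge H(n)+I(n)$ continues as wire $k+\Delta(n)$. Edges are the resulting maximal wire chains; the underlying graph has the vertices of $D$ as vertices and the edges joining two vertices as edges. A right exchange at height $n$ ($0\le n\le N-2$) is admissible when $H(n+1)\ge H(n)+O(n)$ and produces the diagram identical to $D$ except $H'(n)=H(n+1)-\Delta(n)$, $I'(n)=I(n+1)$, $O'(n)=O(n+1)$, $H'(n+1)=H(n)$, $I'(n+1)=I(n)$, $O'(n+1)=O(n)$; it swaps the heights of the two vertices at heights $n,n+1$ (it involves them), vertices keeping their identity. A linear diagram is a valid diagram whose underlying graph is connected, acyclic and has exactly two leaves (vertices incident to only one edge); its vertices are numbered $1,\dots,n$ so that $1$ and $n$ are the leaves and $k$ is adjacent to $k-1$ and $k+1$ for $1<k<n$.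 The cost at weight $w$ of a sequence $r$ of right exchanges on a linear diagram with $n$ vertices is $X+wY$, where $Y$ is the number of exchanges in $r$ involving vertex $n$ and $X$ is the number of exchanges in $r$ not involving vertex $n$. *)

theory Defs
  imports Complex_Main "Graph_Theory.Digraph_Component"
begin

text \<open>A diagram \<open>(S, N, H, I, O)\<close>. The last three components are total functions, of which only
  the values at heights below \<open>N\<close> are meaningful; nothing below depends on the other values.\<close>

record diagram =
  dg_S :: nat
  dg_N :: nat
  dg_H :: "nat \<Rightarrow> nat"
  dg_I :: "nat \<Rightarrow> nat"
  dg_O :: "nat \<Rightarrow> nat"

definition dg_Delta :: "diagram \<Rightarrow> nat \<Rightarrow> int" where
  "dg_Delta D n = int (dg_O D n) - int (dg_I D n)"

primrec dg_W :: "diagram \<Rightarrow> nat \<Rightarrow> int" where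
  "dg_W D 0 = int (dg_S D)"
| "dg_W D (Suc n) = dg_W D n + dg_Delta D n"

definition valid_diagram :: "diagram \<Rightarrow> bool" where
  "valid_diagram D \<longleftrightarrow> (\<forall>n < dg_N D. dg_W D n \<ge> int (dg_H D n + dg_I D n))"


subsection \<open>Wires and the underlying graph\<close>

text \<open>The wire \<open>(n, k)\<close> is the \<open>k\<close>-th wire, from the left, among those crossing level \<open>n\<close>. The vertex
  at height \<open>n\<close> lies between the levels \<open>n\<close> and \<open>n + 1\<close>, so the levels range over \<open>0, ..., N\<close>.\<close>

definition wires :: "diagram \<Rightarrow> (nat \<times> nat) set" where
  "wires D = {(n, k). n \<le> dg_N D \<and> int k < dg_W D n}"

definition input_wires :: "diagram \<Rightarrow> nat \<Rightarrow> (nat \<times> nat) set" where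
  "input_wires D n = {(n, k) | k. dg_H D n \<le> k \<and> k < dg_H D n + dg_I D n}"

definition output_wires :: "diagram \<Rightarrow> nat \<Rightarrow> (nat \<times> nat) set" where
  "output_wires D n = {(Suc n, k) | k. dg_H D n \<le> k \<and> k < dg_H D n + dg_O D n}"

definition wire_continues :: "diagram \<Rightarrow> nat \<times> nat \<Rightarrow> nat \<times> nat \<Rightarrow> bool" where
  "wire_continues D x y \<longleftrightarrow>
     x \<in> wires D \<and> y \<in> wires D \<and> fst x < dg_N D \<and> fst y = Suc (fst x) \<and>
     (snd x < dg_H D (fst x) \<and> snd y = snd x \<or>
      snd x \<ge> dg_H D (fst x) + dg_I D (fst x) \<and> int (snd y) = int (snd x) + dg_Delta D (fst x))"

text \<open>The edges are the maximal wire chains, listed from top to bottom. They include the chains that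
  touch the top or bottom boundary of the diagram.\<close>

definition dg_edges :: "diagram \<Rightarrow> (nat \<times> nat) list set" where
  "dg_edges D = {c. c \<noteq> [] \<and> set c \<subseteq> wires D \<and> successively (wire_continues D) c \<and>
     (\<nexists>x. wire_continues D x (hd c)) \<and> (\<nexists>x. wire_continues D (last c) x)}"

text \<open>The underlying graph is a multigraph. Its vertices are named by their heights in \<open>D\<close>, and each
  edge is an arc from its upper to its lower end: an output wire of the vertex \<open>u\<close> lies on level
  \<open>u + 1\<close>, and an input wire of \<open>v\<close> on level \<open>v\<close>. The orientation is only a bookkeeping device; all
  notions used below are undirected.\<close>

definition underlying_graph :: "diagram \<Rightarrow> (nat, (nat \<times> nat) list) pre_digraph" where
  "underlying_graph D =
     \<lparr> verts = {..<dg_N D},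
       arcs = {c \<in> dg_edges D. (\<exists>u < dg_N D. hd c \<in> output_wires D u) \<and>
                              (\<exists>v < dg_N D. last c \<in> input_wires D v)},
       tail = (\<lambda>c. fst (hd c) - 1),
       head = (\<lambda>c. fst (last c)) \<rparr>"


subsection \<open>Undirected notions for multigraphs\<close>

text \<open>Connectedness is taken from the library, where it already ignores the orientation of the arcs.
  The library's \<^const>\<open>forest\<close> and \<^const>\<open>tree\<close> only exclude directed cycles, so they are not used.
  The cycles below have distinct vertices and distinct edges; loops (length 1) and pairs of
  parallel edges (length 2) are cycles.\<close>

definition joins :: "('a, 'b) pre_digraph \<Rightarrow> 'b \<Rightarrow> 'a \<Rightarrow> 'a \<Rightarrow> bool" where
  "joins G e u v \<longleftrightarrow> e \<in> arcs G \<and> {tail G e, head G e} = {u, v}"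

definition adjacent :: "('a, 'b) pre_digraph \<Rightarrow> 'a \<Rightarrow> 'a \<Rightarrow> bool" where
  "adjacent G u v \<longleftrightarrow> (\<exists>e. joins G e u v)"

definition undirected_cycle :: "('a, 'b) pre_digraph \<Rightarrow> 'a list \<Rightarrow> 'b list \<Rightarrow> bool" where
  "undirected_cycle G vs es \<longleftrightarrow>
     es \<noteq> [] \<and> length vs = length es \<and> distinct vs \<and> distinct es \<and> set vs \<subseteq> verts G \<and>
     (\<forall>i < length es. joins G (es ! i) (vs ! i) (vs ! (Suc i mod length es)))"

definition undirected_acyclic :: "('a, 'b) pre_digraph \<Rightarrow> bool" where
  "undirected_acyclic G \<longleftrightarrow> (\<nexists>vs es. undirected_cycle G vs es)"

definition leaves :: "('a, 'b) pre_digraph \<Rightarrow> 'a set" where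
  "leaves G = {v \<in> verts G. card {e \<in> arcs G. tail G e = v \<or> head G e = v} = 1}"


subsection \<open>Linear diagrams\<close>

definition linear_diagram :: "diagram \<Rightarrow> bool" where
  "linear_diagram D \<longleftrightarrow> valid_diagram D \<and>
     Digraph_Component.connected (underlying_graph D) \<and>
     undirected_acyclic (underlying_graph D) \<and>
     card (leaves (underlying_graph D)) = 2"

text \<open>\<open>p k\<close> is the vertex numbered \<open>k\<close>. There are two such numberings, reverses of each other.\<close>

definition linear_numbering :: "diagram \<Rightarrow> (nat \<Rightarrow> nat) \<Rightarrow> bool" where
  "linear_numbering D p \<longleftrightarrow>
     (let G = underlying_graph D; n = dg_N D in
       bij_betw p {1..n} (verts G) \<and> p 1 \<in> leaves G \<and> p n \<in> leaves G \<and>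
       (\<forall>k. 1 < k \<and> k < n \<longrightarrow> adjacent G (p k) (p (k - 1)) \<and> adjacent G (p k) (p (k + 1))))"


subsection \<open>Right exchanges\<close>

definition right_admissible :: "diagram \<Rightarrow> nat \<Rightarrow> bool" where
  "right_admissible D n \<longleftrightarrow> Suc n < dg_N D \<and> dg_H D (Suc n) \<ge> dg_H D n + dg_O D n"

text \<open>The new \<open>H\<close> at height \<open>n\<close> is \<open>H(n+1) - \<Delta>(n)\<close>; the natural number subtraction does not truncate
  when the exchange is admissible.\<close>

definition right_exchange :: "diagram \<Rightarrow> nat \<Rightarrow> diagram" where
  "right_exchange D n = D
     \<lparr> dg_H := (dg_H D)(n := dg_H D (Suc n) + dg_I D n - dg_O D n, Suc n := dg_H D n),
       dg_I := (dg_I D)(n := dg_I D (Suc n), Suc n := dg_I D n),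
       dg_O := (dg_O D)(n := dg_O D (Suc n), Suc n := dg_O D n) \<rparr>"

text \<open>A sequence of exchanges is given by the list of the heights at which they are performed.\<close>

fun right_exchange_seq :: "diagram \<Rightarrow> nat list \<Rightarrow> bool" where
  "right_exchange_seq D [] \<longleftrightarrow> True"
| "right_exchange_seq D (n # r) \<longleftrightarrow>
     right_admissible D n \<and> right_exchange_seq (right_exchange D n) r"

text \<open>\<open>l h\<close> is the identity of the vertex currently at height \<open>h\<close>; the result lists, for each exchange,
  the two vertices it involves. Vertices are identified by their heights in the initial diagram,
  so that the initial \<open>l\<close> is \<^const>\<open>id\<close>.\<close>

fun involved_vertices :: "(nat \<Rightarrow> nat) \<Rightarrow> nat list \<Rightarrow> nat set list" where
  "involved_vertices l [] = []"
| "involved_vertices l (h # r) =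
     {l h, l (Suc h)} # involved_vertices (l(h := l (Suc h), Suc h := l h)) r"

text \<open>The cost at weight \<open>w\<close>, where \<open>v\<close> is the vertex whose exchanges are weighted.\<close>

definition exchange_cost :: "nat \<Rightarrow> nat \<Rightarrow> nat list \<Rightarrow> nat" where
  "exchange_cost w v r =
     length (filter (\<lambda>A. v \<notin> A) (involved_vertices id r)) +
     w * length (filter (\<lambda>A. v \<in> A) (involved_vertices id r))"

end

theory Submission
  imports Defs "HOL-Combinatorics.Transposition"
begin

text \<open>Two vertices joined by an edge are never exchanged with each other. Any third vertex \<open>k\<close> meets
  the edge from \<open>a\<close> down to \<open>b\<close> in a fixed cyclic order: from above the edge it passes \<open>a\<close> and goes
  to its left, then passes \<open>b\<close> and goes below, then passes \<open>b\<close> and goes to its right, then passes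
  \<open>a\<close> and returns above. So the number of exchanges of \<open>k\<close> with \<open>a\<close> minus that with \<open>b\<close> is the
  change of a potential with values in \<open>{-1, 0, 1}\<close>, and is at most 2. Moving along the path, the
  vertices numbered \<open>i < j\<close> are exchanged at most \<open>2 (j - i)\<close> times, and summing over
  all pairs gives the bound with \<open>C = 2\<close>.\<close>

section \<open>The edge as a sequence of wires, and the effect of one exchange on it\<close>

text \<open>The edge crosses level \<open>h\<close> as the wire number \<open>e h\<close>, for \<open>i < h \<le> j\<close>.\<close>

definition edge_path :: "diagram \<Rightarrow> nat \<Rightarrow> nat \<Rightarrow> (nat \<Rightarrow> nat) \<Rightarrow> bool" where
  "edge_path D i j e \<longleftrightarrow> i < j \<and>
     dg_H D i \<le> e (Suc i) \<and> e (Suc i) < dg_H D i + dg_O D i \<and>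
     dg_H D j \<le> e j \<and> e j < dg_H D j + dg_I D j \<and>
     (\<forall>h. i < h \<and> h < j \<longrightarrow>
        e h < dg_H D h \<and> e (Suc h) = e h \<or>
        dg_H D h + dg_I D h \<le> e h \<and> e (Suc h) + dg_I D h = e h + dg_O D h)"

text \<open>The potential: \<open>1\<close> for a vertex to the left of the edge, \<open>-1\<close> for one to its right.\<close>

definition side :: "diagram \<Rightarrow> nat \<Rightarrow> nat \<Rightarrow> (nat \<Rightarrow> nat) \<Rightarrow> nat \<Rightarrow> int" where
  "side D i j e k = (if i < k \<and> k < j then if e k < dg_H D k then -1 else 1 else 0)"

lemma abs_side_le: "\<bar>side D i j e k\<bar> \<le> 1"
  by (simp add: side_def)

text \<open>If the edge ran from height \<open>m\<close> to \<open>Suc m\<close>, its wire number on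
  level \<open>Suc m\<close> would be below \<open>dg_H D m + dg_O D m\<close>, as an output, and at
  least \<open>dg_H D (Suc m)\<close>, as an input. Admissibility forbids this.\<close>

lemma edge_path_not_exchanged:
  assumes "edge_path D i j e" "right_admissible D m"
  shows "{i, j} \<noteq> {m, Suc m}"
  using assms by (auto simp: edge_path_def right_admissible_def doubleton_eq_iff)

lemma right_exchange_simps:
  "dg_N (right_exchange D m) = dg_N D"
  "dg_H (right_exchange D m) =
     (dg_H D)(m := dg_H D (Suc m) + dg_I D m - dg_O D m, Suc m := dg_H D m)"
  "dg_I (right_exchange D m) = (dg_I D)(m := dg_I D (Suc m), Suc m := dg_I D m)"
  "dg_O (right_exchange D m) = (dg_O D)(m := dg_O D (Suc m), Suc m := dg_O D m)"
  by (simp_all add: right_exchange_def)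

text \<open>The arguments \<open>i\<close>, \<open>j\<close>, \<open>k\<close> are current heights;
  \<open>s\<close> gives the heights of the same vertices after the exchange. The moves past
  \<open>i\<close> (from above to the left, from the right to above) both raise the potential, those
  past \<open>j\<close> (from the left to below, from below to the right) both lower it, and passing
  any other vertex leaves \<open>k\<close> on the same side.\<close>

lemma edge_path_right_exchange:
  assumes E: "edge_path D i j e" and adm: "right_admissible D m"
  defines "s \<equiv> transpose m (Suc m)"
  obtains e' where "edge_path (right_exchange D m) (s i) (s j) e'"
    and "\<And>k. k \<noteq> i \<Longrightarrow> k \<noteq> j \<Longrightarrow>
      side (right_exchange D m) (s i) (s j) e' (s k) =
        side D i j e k + of_bool ({i, k} = {m, Suc m}) - of_bool ({j, k} = {m, Suc m})"
proof -
  \<comment> \<open>The wire followed by the edge on level \<open>m + 1\<close>, the only level that the exchange changes; the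
    value is irrelevant when the new edge does not cross that level.\<close>
  define x where "x = (if Suc m = i then e (Suc (Suc m)) + dg_I D m - dg_O D m
    else if e m < dg_H D (Suc m) + dg_I D m - dg_O D m then e m
    else e m + dg_O D (Suc m) - dg_I D (Suc m))"
  define e' where "e' = e(Suc m := x)"
  define D' where "D' = right_exchange D m"
  have a: "dg_H D (Suc m) \<ge> dg_H D m + dg_O D m"
    using adm by (simp add: right_admissible_def)
  have ij: "i < j" and ei: "dg_H D i \<le> e (Suc i)" "e (Suc i) < dg_H D i + dg_O D i"
    and ej: "dg_H D j \<le> e j" "e j < dg_H D j + dg_I D j"
    and eh: "\<And>h. i < h \<Longrightarrow> h < j \<Longrightarrow> e h < dg_H D h \<and> e (Suc h) = e h \<or>
        dg_H D h + dg_I D h \<le> e h \<and> e (Suc h) + dg_I D h = e h + dg_O D h"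
    using E by (auto simp: edge_path_def)
  have ne: "\<not> (i = m \<and> j = Suc m)"
    using edge_path_not_exchanged[OF E adm] by auto
  have at_m: "dg_H D' m + dg_O D m = dg_H D (Suc m) + dg_I D m"
      "dg_I D' m = dg_I D (Suc m)" "dg_O D' m = dg_O D (Suc m)"
    and at_Suc: "dg_H D' (Suc m) = dg_H D m"
      "dg_I D' (Suc m) = dg_I D m" "dg_O D' (Suc m) = dg_O D m"
    and off: "\<And>h. h \<noteq> m \<Longrightarrow> h \<noteq> Suc m \<Longrightarrow>
      dg_H D' h = dg_H D h \<and> dg_I D' h = dg_I D h \<and> dg_O D' h = dg_O D h"
    using a by (simp_all add: D'_def right_exchange_simps)
  \<comment> \<open>When \<open>i\<close> moves up to height \<open>m\<close>, the new edge has one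
    more level at its top. Its wire there is computed backwards from level
    \<open>Suc (Suc m)\<close>, across the vertex that moved down, which the edge passes on its
    right.\<close>
  have x1: "x + dg_O D m = e (Suc (Suc m)) + dg_I D m" if "Suc m = i"
    using that a ei by (simp add: x_def)
  \<comment> \<open>In the remaining case the wire is computed forwards, by passing wire
    \<open>e m\<close> across the vertex that moved up to height \<open>m\<close>.\<close>
  have x2: "x = (if e m < dg_H D' m then e m else e m + dg_O D (Suc m) - dg_I D (Suc m))"
    if "i < Suc m"
    using that at_m(1) by (simp add: x_def) linarith
  have e'_Suc: "e' (Suc m) = x" and e'_off: "\<And>h. h \<noteq> Suc m \<Longrightarrow> e' h = e h"
    by (simp_all add: e'_def)
  have s: "s m = Suc m" "s (Suc m) = m" "\<And>h. h \<noteq> m \<Longrightarrow> h \<noteq> Suc m \<Longrightarrow> s h = h"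
    by (simp_all add: s_def)
  \<comment> \<open>A transposition of neighbouring heights reverses the order of no other pair, and
    \<open>ne\<close> excludes this one.\<close>
  have lt: "s i < s j"
    using ij ne unfolding s_def transpose_def by (simp split: if_split) linarith
  have off_i: "dg_H D' i \<le> e' (Suc i) \<and> e' (Suc i) < dg_H D' i + dg_O D' i"
    if "i \<noteq> m" "i \<noteq> Suc m"
    using ei off[OF that] e'_off[of "Suc i"] that by simp
  have off_j: "dg_H D' j \<le> e' j \<and> e' j < dg_H D' j + dg_I D' j"
    if "j \<noteq> m" "j \<noteq> Suc m"
    using ej off[OF that] e'_off[of j] that by simp
  have at_i: "dg_H D' (s i) \<le> e' (Suc (s i)) \<and> e' (Suc (s i)) < dg_H D' (s i) + dg_O D' (s i)"
  proof -
    consider "i = m" | "i = Suc m" | "i \<noteq> m" "i \<noteq> Suc m" by blast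
    then show ?thesis
    proof cases
      case 1
      then have "Suc m < j" using ij ne by simp
      \<comment> \<open>An output of the vertex at \<open>m\<close> lies to the left of the vertex
        at \<open>Suc m\<close>, so it continues with its number unchanged.\<close>
      then have "e (Suc (Suc m)) = e (Suc m)" using 1 eh[of "Suc m"] ei a by auto
      then show ?thesis
        using 1 ei by (simp add: s at_Suc e'_off)
    next
      case 2
      then show ?thesis
        using ei a at_m(1,3) x1 by (simp add: s e'_Suc)
    next
      case 3
      then show ?thesis using off_i by (simp add: s)
    qed
  qed
  have at_j: "dg_H D' (s j) \<le> e' (s j) \<and> e' (s j) < dg_H D' (s j) + dg_I D' (s j)"
  proof -
    consider "j = m" | "j = Suc m" | "j \<noteq> m" "j \<noteq> Suc m" by blast
    then show ?thesis
    proof cases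
      case 1
      \<comment> \<open>The input of \<open>j\<close> lies to the left of the vertex moving up, so
        the edge is prolonged by one level with the same wire number.\<close>
      then have "e m < dg_H D' m" using ej a at_m(1) by simp
      then have "x = e m" using x2 1 ij by simp
      then show ?thesis
        using ej 1 by (simp add: s at_Suc e'_Suc)
    next
      case 2
      then have "i < m" using ij ne by simp
      then show ?thesis
        using 2 eh[of m] ej a at_m(1,2) by (auto simp: s e'_off)
    next
      case 3
      then show ?thesis using off_j by (simp add: s)
    qed
  qed
  \<comment> \<open>The vertex now at \<open>m\<close> was at \<open>Suc m\<close>. If the edge
    passes the old vertex at \<open>m\<close> on the left, or ends there, it is to the left of this
    vertex too; if it passes on the right, wire number and offset both shift by
    \<open>dg_Delta D m\<close>, so the comparison is the same before and after.\<close>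
  have inner_m: "(e m < dg_H D' m \<and> x = e m \<or>
      dg_H D' m + dg_I D' m \<le> e m \<and> x + dg_I D' m = e m + dg_O D' m)"
    and side_m: "Suc m < j \<Longrightarrow> e m < dg_H D' m \<longleftrightarrow> e (Suc m) < dg_H D (Suc m)"
    and side_j: "j = m \<Longrightarrow> e m < dg_H D' m"
    if "i < m" "m < s j"
  proof -
    have x: "x = (if e m < dg_H D' m then e m else e m + dg_O D (Suc m) - dg_I D (Suc m))"
      using x2 that by simp
    have *: "e m < dg_H D' m \<or> Suc m < j \<and> dg_H D' m + dg_I D' m \<le> e m"
    proof -
      have "j \<noteq> Suc m" "\<not> j < m"
        using that(2) s(2) s(3)[of j] by auto
      then consider "Suc m < j" | "j = m"
        by linarith
      then show ?thesis
      proof cases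
        case 1
        then show ?thesis
          using that(1) eh[of m] eh[of "Suc m"] a at_m(1,2) by simp linarith
      next
        case 2
        then show ?thesis
          using ej a at_m(1) by simp
      qed
    qed
    show "(e m < dg_H D' m \<and> x = e m \<or>
      dg_H D' m + dg_I D' m \<le> e m \<and> x + dg_I D' m = e m + dg_O D' m)"
      using * x at_m(2,3) by auto
    show "e m < dg_H D' m \<longleftrightarrow> e (Suc m) < dg_H D (Suc m)" if "Suc m < j"
      using that \<open>i < m\<close> eh[of m] eh[of "Suc m"] a at_m(1,2) by simp linarith
    show "e m < dg_H D' m" if "j = m"
      using ej a at_m(1) that by simp
  qed
  have inner_Suc: "(x < dg_H D' (Suc m) \<and> e (Suc (Suc m)) = x \<or>
      dg_H D' (Suc m) + dg_I D' (Suc m) \<le> x \<and>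
      e (Suc (Suc m)) + dg_I D' (Suc m) = x + dg_O D' (Suc m))"
    and side_Suc: "i < m \<Longrightarrow> x < dg_H D' (Suc m) \<longleftrightarrow> e m < dg_H D m"
    and side_i: "i = Suc m \<Longrightarrow> \<not> x < dg_H D' (Suc m)"
    if "s i < Suc m" "Suc m < j"
  proof -
    have "i \<noteq> m" "\<not> Suc m < i"
      using that(1) s(1) s(3)[of i] by auto
    then consider "i < m" | "i = Suc m"
      by linarith
    then have "(x < dg_H D m \<and> e (Suc (Suc m)) = x \<or>
      dg_H D m + dg_I D m \<le> x \<and>
      e (Suc (Suc m)) + dg_I D m = x + dg_O D m) \<and>
      (i < m \<longrightarrow> (x < dg_H D m \<longleftrightarrow> e m < dg_H D m)) \<and>
      (i = Suc m \<longrightarrow> \<not> x < dg_H D m)"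
    proof cases
      case 1
      then have u: "e m < dg_H D m \<and> e (Suc m) = e m \<or>
        dg_H D m + dg_I D m \<le> e m \<and> e (Suc m) + dg_I D m = e m + dg_O D m"
        and v: "e (Suc m) < dg_H D (Suc m) \<and> e (Suc (Suc m)) = e (Suc m) \<or>
        dg_H D (Suc m) + dg_I D (Suc m) \<le> e (Suc m) \<and>
        e (Suc (Suc m)) + dg_I D (Suc m) = e (Suc m) + dg_O D (Suc m)"
        using eh that by simp_all
      have x: "x = (if e m < dg_H D' m then e m else e m + dg_O D (Suc m) - dg_I D (Suc m))"
        using x2 1 by simp
      \<comment> \<open>The edge is to the left of both vertices, between them, or to the right of
        both. In each case the two shifts commute, so the new chain rejoins the old one on level
        \<open>Suc (Suc m)\<close>.\<close>
      show ?thesis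
      proof (cases "e m < dg_H D' m")
        case True
        then show ?thesis using x u v a at_m(1) 1 by auto
      next
        case False
        then have "dg_H D (Suc m) \<le> e (Suc m)" "dg_H D m + dg_I D m \<le> e m"
          using u a at_m(1) by auto
        then show ?thesis using False x u v a at_m(1) 1 by auto
      qed
    next
      case 2
      then show ?thesis
        using ei a x1 by auto
    qed
    then show "(x < dg_H D' (Suc m) \<and> e (Suc (Suc m)) = x \<or>
      dg_H D' (Suc m) + dg_I D' (Suc m) \<le> x \<and>
      e (Suc (Suc m)) + dg_I D' (Suc m) = x + dg_O D' (Suc m))"
      "i < m \<Longrightarrow> x < dg_H D' (Suc m) \<longleftrightarrow> e m < dg_H D m"
      "i = Suc m \<Longrightarrow> \<not> x < dg_H D' (Suc m)"
      unfolding at_Suc by blast+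
  qed
  have "e' h < dg_H D' h \<and> e' (Suc h) = e' h \<or>
      dg_H D' h + dg_I D' h \<le> e' h \<and> e' (Suc h) + dg_I D' h = e' h + dg_O D' h"
    if h: "s i < h" "h < s j" for h
  proof -
    consider "h = m" | "h = Suc m" | "h \<noteq> m" "h \<noteq> Suc m" by blast
    then show ?thesis
    proof cases
      case 1
      have "s i < m \<Longrightarrow> i < m"
        using s by (cases "i = m"; cases "i = Suc m") auto
      then have "i < m" "m < s j" using h 1 by auto
      then show ?thesis using inner_m 1 by (simp add: e'_Suc e'_off)
    next
      case 2
      have "Suc m < s j \<Longrightarrow> Suc m < j"
        using s by (cases "j = m"; cases "j = Suc m") auto
      then have "s i < Suc m" "Suc m < j" using h 2 by auto
      then show ?thesis using inner_Suc 2 by (simp add: e'_Suc e'_off)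
    next
      case 3
      have "s i < h \<Longrightarrow> i < h"
        using 3 s by (cases "i = m"; cases "i = Suc m") auto
      moreover have "h < s j \<Longrightarrow> h < j"
        using 3 s by (cases "j = m"; cases "j = Suc m") auto
      ultimately have "i < h" "h < j" using h by auto
      then show ?thesis using eh[of h] off[OF 3] 3 by (simp add: e'_off)
    qed
  qed
  then have "edge_path D' (s i) (s j) e'"
    unfolding edge_path_def using lt at_i at_j by blast
  moreover have "side D' (s i) (s j) e' (s k) =
      side D i j e k + of_bool ({i, k} = {m, Suc m}) - of_bool ({j, k} = {m, Suc m})"
    if k: "k \<noteq> i" "k \<noteq> j" for k
  proof -
    consider "k = m" | "k = Suc m" | "k \<noteq> m" "k \<noteq> Suc m" by blast
    then show ?thesis
    proof cases
      \<comment> \<open>Here \<open>k\<close> moves down, being the left vertex of the exchange: it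
        passes a vertex other than the ends, goes from the left of the edge to below
        \<open>j\<close>, goes from above \<open>i\<close> to the left, or stays away from the
        edge.\<close>
      case 1
      consider "i < m" "Suc m < j" | "i < m" "j = Suc m" | "i = Suc m"
        | "Suc m < i \<or> j < m"
        using k ij 1 by linarith
      then show ?thesis
      proof cases
        case 1
        then show ?thesis
          using \<open>k = m\<close> side_Suc s by (simp add: side_def e'_Suc doubleton_eq_iff)
      next
        case 2
        then show ?thesis
          using \<open>k = m\<close> s eh[of m] ej a by (auto simp: side_def doubleton_eq_iff)
      next
        case 3
        then show ?thesis
          using \<open>k = m\<close> ij s side_i by (simp add: side_def e'_Suc doubleton_eq_iff)
      next
        case 4
        then have ne: "i \<noteq> m" "i \<noteq> Suc m" "j \<noteq> m" "j \<noteq> Suc m"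
          using ij by linarith+
        then have "s i = i" "s j = j"
          by (simp_all add: s(3))
        then have "side D' (s i) (s j) e' (s k) = 0"
          using 4 \<open>k = m\<close> s(1) by (auto simp: side_def)
        moreover have "side D i j e k = 0"
          using 4 \<open>k = m\<close> by (auto simp: side_def)
        moreover have "{i, k} \<noteq> {m, Suc m}" "{j, k} \<noteq> {m, Suc m}"
          using ne by (simp_all add: doubleton_eq_iff)
        ultimately show ?thesis
          by simp
      qed
    next
      \<comment> \<open>Here \<open>k\<close> moves up, being the right vertex: it passes a vertex
        other than the ends, goes from the right of the edge to above \<open>i\<close>, goes from
        below \<open>j\<close> to the right, or stays away from the edge.\<close>
      case 2
      consider "i < m" "Suc m < j" | "i = m" "Suc m < j" | "i < m" "j = m"
        | "Suc m < i \<or> j < m"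
        using k ij 2 by linarith
      then show ?thesis
      proof cases
        case 1
        then show ?thesis
          using \<open>k = Suc m\<close> side_m s by (simp add: side_def e'_off doubleton_eq_iff)
      next
        case 2
        then show ?thesis
          using \<open>k = Suc m\<close> s ei a by (auto simp: side_def doubleton_eq_iff)
      next
        case 3
        then show ?thesis
          using \<open>k = Suc m\<close> s side_j by (simp add: side_def e'_off doubleton_eq_iff)
      next
        case 4
        then have ne: "i \<noteq> m" "i \<noteq> Suc m" "j \<noteq> m" "j \<noteq> Suc m"
          using ij by linarith+
        then have "s i = i" "s j = j"
          by (simp_all add: s(3))
        then have "side D' (s i) (s j) e' (s k) = 0"
          using 4 \<open>k = Suc m\<close> s(2) by (auto simp: side_def)
        moreover have "side D i j e k = 0"
          using 4 \<open>k = Suc m\<close> by (auto simp: side_def)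
        moreover have "{i, k} \<noteq> {m, Suc m}" "{j, k} \<noteq> {m, Suc m}"
          using ne by (simp_all add: doubleton_eq_iff)
        ultimately show ?thesis
          by simp
      qed
    next
      case 3
      have "s i < k \<longleftrightarrow> i < k"
        using 3 k s(1,2) s(3)[of i] by (cases "i = m"; cases "i = Suc m") auto
      moreover have "k < s j \<longleftrightarrow> k < j"
        using 3 k s(1,2) s(3)[of j] by (cases "j = m"; cases "j = Suc m") auto
      ultimately show ?thesis
        using 3 s(3)[OF 3] off[OF 3] by (simp add: side_def e'_off doubleton_eq_iff)
    qed
  qed
  ultimately show thesis
    using that unfolding D'_def by blast
qed

section \<open>Counting exchanges along a sequence\<close>

text \<open>Updating heights and labelling together keeps the identity of a vertex, so the
  inductions below can speak of the same pair throughout.\<close>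

lemma swap_comp_transpose: "(l(h := l (Suc h), Suc h := l h)) (transpose h (Suc h) x) = l x"
  by (auto simp: transpose_def)

lemma inj_swap: "inj l \<Longrightarrow> inj (l(h := l (Suc h), Suc h := l h))"
  by (auto simp: inj_def)

lemma involved_pair_iff:
  fixes l :: "nat \<Rightarrow> nat"
  assumes "inj l"
  shows "{l m, l (Suc m)} = {l i, l k} \<longleftrightarrow> {i, k} = {m, Suc m}"
  using assms by (auto simp: doubleton_eq_iff inj_eq)

lemma count_involved_edge:
  assumes "right_exchange_seq D r" "edge_path D i j e" "inj l"
  shows "count_list (involved_vertices l r) {l i, l j} = 0"
  using assms
proof (induction r arbitrary: D i j e l)
  case (Cons m r)
  let ?s = "transpose m (Suc m)" and ?l = "l(m := l (Suc m), Suc m := l m)"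
  have adm: "right_admissible D m" and r: "right_exchange_seq (right_exchange D m) r"
    using Cons.prems by auto
  obtain e' where "edge_path (right_exchange D m) (?s i) (?s j) e'"
    using edge_path_right_exchange[OF Cons.prems(2) adm] by blast
  from Cons.IH[OF r this inj_swap[OF Cons.prems(3), of m]]
  have "count_list (involved_vertices ?l r) {l i, l j} = 0"
    unfolding swap_comp_transpose[of l m] .
  then show ?case
    using edge_path_not_exchanged[OF Cons.prems(2) adm] involved_pair_iff[OF Cons.prems(3)]
    by simp
qed simp

text \<open>The quantity between the bars is the potential of \<open>k\<close> after the last
  exchange, since the changes telescope. Keeping the initial potential inside makes the induction go
  through.\<close>

lemma count_involved_side:
  assumes "right_exchange_seq D r" "edge_path D i j e" "inj l" "k \<noteq> i" "k \<noteq> j"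
  shows "\<bar>side D i j e k + int (count_list (involved_vertices l r) {l i, l k})
           - int (count_list (involved_vertices l r) {l j, l k})\<bar> \<le> 1"
  using assms
proof (induction r arbitrary: D i j e l k)
  case Nil
  then show ?case by (simp add: abs_side_le)
next
  case (Cons m r)
  let ?s = "transpose m (Suc m)" and ?l = "l(m := l (Suc m), Suc m := l m)"
  have adm: "right_admissible D m" and r: "right_exchange_seq (right_exchange D m) r"
    using Cons.prems by auto
  obtain e' where e': "edge_path (right_exchange D m) (?s i) (?s j) e'"
    and s: "side (right_exchange D m) (?s i) (?s j) e' (?s k) =
        side D i j e k + of_bool ({i, k} = {m, Suc m}) - of_bool ({j, k} = {m, Suc m})"
    using edge_path_right_exchange[OF Cons.prems(2) adm] Cons.prems(4,5) by metis
  have "?s k \<noteq> ?s i" "?s k \<noteq> ?s j"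
    using Cons.prems(4,5) by (metis transpose_involutory)+
  from Cons.IH[OF r e' inj_swap[OF Cons.prems(3), of m] this]
  have "\<bar>side (right_exchange D m) (?s i) (?s j) e' (?s k)
      + int (count_list (involved_vertices ?l r) {l i, l k})
      - int (count_list (involved_vertices ?l r) {l j, l k})\<bar> \<le> 1"
    unfolding swap_comp_transpose[of l m] .
  then show ?case
    unfolding s
    using involved_pair_iff[OF Cons.prems(3), of m i k] involved_pair_iff[OF Cons.prems(3), of m j k]
    by (cases "{i, k} = {m, Suc m}"; cases "{j, k} = {m, Suc m}") simp_all
qed

section \<open>Arcs and adjacency in the underlying graph\<close>

lemma edge_path_of_arc:
  assumes "c \<in> arcs (underlying_graph D)"
  obtains e where
    "edge_path D (tail (underlying_graph D) c) (head (underlying_graph D) c) e"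
proof -
  obtain u v where c: "c \<noteq> []" "successively (wire_continues D) c"
    "hd c \<in> output_wires D u" "last c \<in> input_wires D v"
    using assms by (auto simp: underlying_graph_def dg_edges_def)
  have u: "fst (hd c) = Suc u" and v: "fst (last c) = v"
    using c by (auto simp: output_wires_def input_wires_def)
  have step: "wire_continues D (c ! t) (c ! Suc t)" if "Suc t < length c" for t
    using c(2) that by (simp add: successively_conv_nth)
  have level: "fst (c ! t) = Suc u + t" if "t < length c" for t
    using that
  proof (induction t)
    case 0
    then show ?case using u c(1) by (simp add: hd_conv_nth)
  next
    case (Suc t)
    then show ?case using step[of t] by (simp add: wire_continues_def)
  qed
  have len: "v = u + length c"
    using level[of "length c - 1"] v c(1) by (cases c) (auto simp: last_conv_nth)
  \<comment> \<open>Entry \<open>t\<close> of the chain lies on level \<open>Suc u + t\<close>, so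
    this is the wire number of the entry on level \<open>h\<close>.\<close>
  define e where "e h = snd (c ! (h - Suc u))" for h
  have "edge_path D u v e"
    unfolding edge_path_def
  proof (intro conjI allI impI)
    show "u < v" using len c(1) by simp
    show "dg_H D u \<le> e (Suc u)" "e (Suc u) < dg_H D u + dg_O D u"
      using c(1,3) by (auto simp: e_def output_wires_def hd_conv_nth)
    show "dg_H D v \<le> e v" "e v < dg_H D v + dg_I D v"
      using c(1,4) len by (auto simp: e_def input_wires_def last_conv_nth)
  next
    fix h assume h: "u < h \<and> h < v"
    then have t: "Suc (h - Suc u) < length c" "Suc h - Suc u = Suc (h - Suc u)"
      using len by auto
    then have "fst (c ! (h - Suc u)) = h"
      using level[of "h - Suc u"] h by simp
    with step[OF t(1)] t(2)
    show "e h < dg_H D h \<and> e (Suc h) = e h \<or>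
        dg_H D h + dg_I D h \<le> e h \<and> e (Suc h) + dg_I D h = e h + dg_O D h"
      by (auto simp: e_def wire_continues_def dg_Delta_def)
  qed
  then show thesis
    using that u v by (simp add: underlying_graph_def)
qed

lemma edge_path_of_adjacent:
  assumes "adjacent (underlying_graph D) x y"
  obtains e where "edge_path D x y e \<or> edge_path D y x e"
proof -
  obtain c where "c \<in> arcs (underlying_graph D)"
    "{tail (underlying_graph D) c, head (underlying_graph D) c} = {x, y}"
    using assms by (auto simp: adjacent_def joins_def)
  then show thesis
    using edge_path_of_arc that by (metis doubleton_eq_iff)
qed

lemma count_adjacent:
  assumes "right_exchange_seq D r" "adjacent (underlying_graph D) x y"
  shows "count_list (involved_vertices id r) {x, y} = 0"
proof -
  obtain e where "edge_path D x y e \<or> edge_path D y x e"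
    using edge_path_of_adjacent[OF assms(2)] by blast
  then show ?thesis
    using count_involved_edge[OF assms(1) _ inj_on_id, where i = x and j = y and e = e]
      count_involved_edge[OF assms(1) _ inj_on_id, where i = y and j = x and e = e]
    by (auto simp: insert_commute)
qed

text \<open>Up to the sign given by the direction of the edge, the difference of the counts is the
  final minus the initial potential. Both lie between -1 and 1, hence the 2.\<close>

lemma count_adjacent_le:
  assumes "right_exchange_seq D r" "adjacent (underlying_graph D) x y" "k \<noteq> x" "k \<noteq> y"
  shows "count_list (involved_vertices id r) {x, k}
       \<le> count_list (involved_vertices id r) {y, k} + 2"
proof -
  obtain e where "edge_path D x y e \<or> edge_path D y x e"
    using edge_path_of_adjacent[OF assms(2)] by blast
  then show ?thesis
    using count_involved_side[OF assms(1) _ inj_on_id, where i = x and j = y and e = e and k = k]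
      count_involved_side[OF assms(1) _ inj_on_id, where i = y and j = x and e = e and k = k]
      abs_side_le[of D x y e k] abs_side_le[of D y x e k] assms(3,4)
    by auto
qed

lemma involved_vertices_pairs:
  assumes "right_exchange_seq D r" "inj l" "l ` {..<dg_N D} \<subseteq> {..<dg_N D}"
    "A \<in> set (involved_vertices l r)"
  shows "\<exists>x y. A = {x, y} \<and> x \<noteq> y \<and> x < dg_N D \<and> y < dg_N D"
  using assms
proof (induction r arbitrary: D l)
  case (Cons m r)
  let ?l = "l(m := l (Suc m), Suc m := l m)"
  have m: "Suc m < dg_N D" and r: "right_exchange_seq (right_exchange D m) r"
    using Cons.prems by (simp_all add: right_admissible_def)
  then have b: "l m < dg_N D" "l (Suc m) < dg_N D"
    using Cons.prems(3) Suc_lessD[OF m] by (simp_all add: image_subset_iff)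
  show ?case
  proof (cases "A = {l m, l (Suc m)}")
    case True
    then show ?thesis
      using b Cons.prems(2) by (metis inj_eq n_not_Suc_n)
  next
    case False
    then have A: "A \<in> set (involved_vertices ?l r)"
      using Cons.prems(4) by simp
    have "?l ` {..<dg_N D} \<subseteq> {..<dg_N D}"
      using Cons.prems(3) b by auto
    then show ?thesis
      using Cons.IH[OF r inj_swap[OF Cons.prems(2)] _ A] by (simp only: right_exchange_simps)
  qed
qed simp

section \<open>Exchanges of two vertices on the path\<close>

text \<open>For more than two vertices, one of two consecutive ones is interior and the numbering
  gives the adjacency. For exactly two, it comes from the edge at the leaf.\<close>

lemma linear_numbering_adjacent:
  assumes num: "linear_numbering D p" and i: "1 \<le> i" "Suc i \<le> dg_N D"
  shows "adjacent (underlying_graph D) (p (Suc i)) (p i)"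
proof -
  let ?G = "underlying_graph D" and ?n = "dg_N D"
  have bij: "bij_betw p {1..?n} {..<?n}" and leaf: "p 1 \<in> leaves ?G"
    and mid: "\<And>k. 1 < k \<Longrightarrow> k < ?n \<Longrightarrow>
      adjacent ?G (p k) (p (k - 1)) \<and> adjacent ?G (p k) (p (k + 1))"
    using num by (auto simp: linear_numbering_def Let_def underlying_graph_def)
  consider "1 < i" | "i = 1" "2 < ?n" | "i = 1" "?n = 2"
    using i by linarith
  then show ?thesis
  proof cases
    case 1
    then show ?thesis
      using mid[of i] i by (auto simp: adjacent_def joins_def insert_commute)
  next
    case 2
    then show ?thesis
      using mid[of 2] by (simp add: numeral_2_eq_2)
  next
    case 3
    have "{e \<in> arcs ?G. tail ?G e = p 1 \<or> head ?G e = p 1} \<noteq> {}"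
      using leaf by (auto simp: leaves_def simp del: Collect_empty_eq)
    then obtain c where c: "c \<in> arcs ?G" "tail ?G c = p 1 \<or> head ?G c = p 1"
      by auto
    have "{1..?n} = {1, 2}"
      using 3 by auto
    then have "{..<?n} = {p 1, p 2}"
      using bij by (simp add: bij_betw_def)
    moreover have "tail ?G c \<in> {..<?n}" "head ?G c \<in> {..<?n}"
      using c(1) by (auto simp: underlying_graph_def output_wires_def input_wires_def)
    ultimately have "tail ?G c = p 1 \<or> tail ?G c = p 2" "head ?G c = p 1 \<or> head ?G c = p 2"
      by simp_all
    \<comment> \<open>Arcs lead strictly downwards, so the edge at the leaf is no loop and must
      reach the other vertex.\<close>
    moreover have "tail ?G c \<noteq> head ?G c"
      using edge_path_of_arc[OF c(1)] by (metis edge_path_def less_irrefl)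
    ultimately have "{tail ?G c, head ?G c} = {p 2, p 1}"
      using c(2) by auto
    then show ?thesis
      using c(1) 3 by (auto simp: adjacent_def joins_def numeral_2_eq_2)
  qed
qed

text \<open>Induction on \<open>j\<close>, starting from the neighbour of \<open>i\<close>, which is
  never exchanged with \<open>i\<close>; each further step along the path adds at most 2.\<close>

lemma count_linear_le:
  assumes seq: "right_exchange_seq D r" and num: "linear_numbering D p"
    and "1 \<le> i" "i < j" "j \<le> dg_N D"
  shows "count_list (involved_vertices id r) {p j, p i} \<le> 2 * (j - i)"
proof -
  have inj: "inj_on p {1..dg_N D}"
    using num by (simp add: linear_numbering_def Let_def bij_betw_def)
  define L where "L = involved_vertices id r"
  have adj: "adjacent (underlying_graph D) (p (Suc k)) (p k)" if "i \<le> k" "Suc k \<le> dg_N D" for k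
    using linear_numbering_adjacent[OF num] that \<open>1 \<le> i\<close> by simp
  from \<open>i < j\<close> have "Suc i \<le> j" by simp
  then have "count_list L {p j, p i} \<le> 2 * (j - i)"
    using \<open>j \<le> dg_N D\<close>
  proof (induction j rule: dec_induct)
    case base
    then show ?case
      using count_adjacent[OF seq adj[of i]] by (simp add: L_def)
  next
    case (step k)
    have "p i \<noteq> p (Suc k)" "p i \<noteq> p k"
      using inj_on_eq_iff[OF inj, of i "Suc k"] inj_on_eq_iff[OF inj, of i k]
        step.prems step.hyps \<open>1 \<le> i\<close> by auto
    then have "count_list L {p (Suc k), p i} \<le> count_list L {p k, p i} + 2"
      using count_adjacent_le[OF seq adj[of k]] step.prems step.hyps by (simp add: L_def)
    then show ?case
      using step by auto
  qed
  then show ?thesis by (simp add: L_def)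
qed

section \<open>Summing over pairs of vertices\<close>

lemma length_le_card_mult:
  assumes "set xs \<subseteq> X" "finite X" "card X \<le> c" "\<And>x. x \<in> set xs \<Longrightarrow> count_list xs x \<le> b"
  shows "length xs \<le> c * b"
proof -
  have "length xs = (\<Sum>x\<in>X. count_list xs x)"
    using sum_count_set[OF assms(1,2)] by simp
  also have "\<dots> \<le> (\<Sum>x\<in>X. b)"
    using assms(4) by (intro sum_mono) (metis count_notin le0)
  also have "\<dots> \<le> c * b"
    using assms(3) by simp
  finally show ?thesis .
qed

lemma count_list_filter_le: "count_list (filter P xs) x \<le> count_list xs x"
  by (induction xs) auto

theorem theorem35:
  shows "\<exists>C :: real. \<forall>(D :: diagram) (p :: nat \<Rightarrow> nat) (n :: nat) (w :: nat) (r :: nat list).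
    linear_diagram D \<longrightarrow> n = dg_N D \<longrightarrow> linear_numbering D p \<longrightarrow> right_exchange_seq D r \<longrightarrow>
    real (exchange_cost w (p n) r) \<le> C * (real n ^ 3 + real w * real n ^ 2)"
proof (intro exI[of _ 2] allI impI)
  fix D p n w r
  assume n: "n = dg_N D" and num: "linear_numbering D p" and seq: "right_exchange_seq D r"
  let ?L = "involved_vertices id r"
  \<comment> \<open>Both families may contain singletons and \<open>?X\<close> lists pairs twice;
    upper bounds on their cardinalities suffice.\<close>
  let ?X = "(\<lambda>(i, j). {p i, p j}) ` ({1..n} \<times> {1..n})" and ?Y = "(\<lambda>i. {p n, p i}) ` {1..n}"
  have bij: "bij_betw p {1..n} {..<n}"
    using num n by (simp add: linear_numbering_def Let_def underlying_graph_def)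
  have pair: "\<exists>i j. A = {p i, p j} \<and> i \<in> {1..n} \<and> j \<in> {1..n} \<and> i < j"
    if A: "A \<in> set ?L" for A
  proof -
    obtain x y where xy: "A = {x, y}" "x \<noteq> y" "x \<in> p ` {1..n}" "y \<in> p ` {1..n}"
      using involved_vertices_pairs[OF seq inj_on_id _ A] n bij
      by (auto simp: bij_betw_def simp flip: lessThan_iff)
    then obtain i j where "x = p i" "y = p j" "i \<in> {1..n}" "j \<in> {1..n}" "i \<noteq> j"
      by blast
    then show ?thesis
      using xy(1) by (metis insert_commute linorder_neqE_nat)
  qed
  have count: "count_list (filter P ?L) A \<le> 2 * n" if A: "A \<in> set (filter P ?L)" for A P
  proof -
    obtain i j where ij: "A = {p i, p j}" "i \<in> {1..n}" "j \<in> {1..n}" "i < j"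
      using pair[of A] A by auto
    then have "count_list ?L A \<le> 2 * (j - i)"
      using count_linear_le[OF seq num, of i j] n by (simp add: insert_commute)
    then show ?thesis
      using count_list_filter_le[of P ?L A] ij by simp
  qed
  have "set (filter (\<lambda>A. p n \<notin> A) ?L) \<subseteq> ?X"
    using pair by fastforce
  moreover have "card ?X \<le> n * n"
    by (rule order_trans[OF card_image_le]) (auto simp: card_cartesian_product)
  ultimately have X: "length (filter (\<lambda>A. p n \<notin> A) ?L) \<le> n * n * (2 * n)"
    by (intro length_le_card_mult[OF _ _ _ count]) auto
  \<comment> \<open>A pair containing \<open>p n\<close> is determined by its other vertex. This
    saves the factor \<open>n\<close> in the weighted term.\<close>
  have "set (filter (\<lambda>A. p n \<in> A) ?L) \<subseteq> ?Y"
    using pair by fastforce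
  moreover have "card ?Y \<le> n"
    by (rule order_trans[OF card_image_le]) auto
  ultimately have Y: "length (filter (\<lambda>A. p n \<in> A) ?L) \<le> n * (2 * n)"
    by (intro length_le_card_mult[OF _ _ _ count]) auto
  have "exchange_cost w (p n) r \<le> n * n * (2 * n) + w * (n * (2 * n))"
    unfolding exchange_cost_def using X Y by (intro add_mono mult_left_mono) auto
  then have "real (exchange_cost w (p n) r) \<le> real (n * n * (2 * n) + w * (n * (2 * n)))"
    by (rule of_nat_mono)
  then show "real (exchange_cost w (p n) r) \<le> 2 * (real n ^ 3 + real w * real n ^ 2)"
    by (simp add: algebra_simps power2_eq_square power3_eq_cube)
qed

end
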